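(* Let $p/q:\mathcal{Z}\dashrightarrow\mathbb{P}^1(\mathbb{C})$ be a meromorphic function (local or global setting), $f:X\to\mathbb{C}$ the induced holomorphic function, $F=F_s$ the general fibre over the base point $s$, and $a_i$ the atypical values of $f$ in $\mathbb{C}$. Identify $H_*(X,F)$ with $\bigoplus_{a_i\in\Lambda_f\setminus\{\infty\}}H_*(F_{D_i},F)$ by the isomorphism induced by the inclusions of pairs. Then, for every $i$ and every $\omega\in H_*(X,F)$, the monodromy $T_i$ around $a_i$ acting on $H_*(X,F)$ satisfies $$T_i(\omega)=\omega+\psi_i(\omega)$$ for some $\psi_i(\omega)\in H_*(F_{D_i},F)$.
   Context: Setting (local or global). Local: $(\mathcal{Z},x)$ is the germ of a complex manifold of dimension $n$ and $p,q$ are holomorphic germs at $x$ (one works with small representatives). Global: $\mathcal{Z}$ is a connected compact complex manifold of dimension $n$ and $p,q$ are sections of a holomorphic line bundle $L\to\mathcal{Z}$. The same notation is used for both. $X:=\mathcal{Z}\setminus\{q=0\}$ and $f=p/q:X\to\mathbb{C}$. The completed space is $\mathbb{X}=\{(z,[t:s])\in\mathcal{Z}\times\mathbb{P}^1 : s\,p(z)-t\,q(z)=0\}$, with projection $\pi:\mathbb{X}\to\mathbb{P}^1$; $\mathbb{C}=\mathbb{P}^1\setminus\{\infty\}$ with $\infty=[1:0]$. $X$ is identified with its graph in $\mathbb{X}$, so $\pi_{|X}=f$. Endow $\mathbb{X}$ with a locally finite Whitney stratification having $X$ as a stratum; $\Lambda_f\subset\mathbb{P}^1$ is the minimal (finite)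 set such that the stratified projection $\pi$ is locally topologically trivial over $\mathbb{P}^1\setminus\Lambda_f$; in particular $f$ is a locally trivial $C^\infty$-fibration over $\mathbb{C}\setminus\Lambda_f$. For $A\subset\mathbb{C}$, $F_A:=f^{-1}(A)$. Paths. Let $\hat D\subset\mathbb{C}$ be a closed disc big enough to contain $\Lambda_f\setminus\{\infty\}$. For each $a_i\in\Lambda_f\setminus\{\infty\}$ let $D_i\subset\hat D$ be a small enough closed disc centered at $a_i$ with $D_i\cap\Lambda_f=\{a_i\}$. Fix $s\in\partial\hat D$ and, for each $i$, a path $\gamma_i\subset\hat D$ from $s$ to a fixed point $s_i\in\partial D_i$, without self-intersections and meeting any other path $\gamma_j$ only at $s$. Set $F:=F_s$; $F$ is identified with $F_{s_i}$ by transport along $\gamma_i$, and $H_*(F_{D_i},F)$ means $H_*(F_{D_i},F_{s_i})$ under this identification. Excision gives an isomorphism, induced by the inclusions of pairs (with transport along the $\gamma_i$), $\bigoplus_{a_i}H_*(F_{D_i},F_{s_i})\to H_*(X,F_s)$; in particular each $H_*(F_{D_i},F)$ is a direct summand of $H_*(X,F)$. Homology is with coefficients in $\mathbb{Z}$. Monodromy. The monodromy $h_i$ around $a_i$ is induced by the counterclockwise loop around $\partial D_i$ (based at $s$ through $\gamma_i$): moving the point $s$ along this loop is realized by an isotopy of $\mathbb{C}$ fixed near $\Lambda_f$, which lifts to an isotopy of $X$ starting from the identity and ending with a map of the pair $(X,F)$ to itself. $T_i:H_*(X,F)\to H_*(X,F)$ denotes its action in homology. *)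

theory Defs
  imports "HOL-Analysis.Analysis" "HOL-Homology.Homology"
begin

section \<open>Complex manifolds and holomorphic line bundles\<close>

text \<open>Holomorphy on an open set \<open>S\<close>: Frechet differentiable with complex linear derivative.\<close>

definition holo_on :: "(complex^'n::finite) set \<Rightarrow> (complex^'n \<Rightarrow> complex) \<Rightarrow> bool" where
  "holo_on S g \<longleftrightarrow>
     (\<forall>x\<in>S. \<exists>D. (g has_derivative D) (at x) \<and> (\<forall>c v. D (c *s v) = c * D v))"

definition vec_holo_on ::
    "(complex^'n::finite) set \<Rightarrow> (complex^'n \<Rightarrow> complex^'m::finite) \<Rightarrow> bool" where
  "vec_holo_on S g \<longleftrightarrow> (\<forall>i. holo_on S (\<lambda>x. g x $ i))"

type_synonym ('a, 'n) chart = "'a set \<times> ('a \<Rightarrow> complex^'n)"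

definition is_chart :: "'a topology \<Rightarrow> ('a, 'n::finite) chart \<Rightarrow> bool" where
  "is_chart Z = (\<lambda>(U, \<phi>).
     openin Z U \<and> open (\<phi> ` U) \<and> homeomorphic_map (subtopology Z U) (top_of_set (\<phi> ` U)) \<phi>)"

definition transition_holo :: "('a, 'n::finite) chart \<Rightarrow> ('a, 'n) chart \<Rightarrow> bool" where
  "transition_holo = (\<lambda>(U, \<phi>) (V, \<psi>). vec_holo_on (\<phi> ` (U \<inter> V)) (\<psi> \<circ> inv_into U \<phi>))"

text \<open>Membership in the maximal atlas determined by \<open>\<A>\<close>.\<close>

definition compatible_chart ::
    "'a topology \<Rightarrow> ('a, 'n::finite) chart set \<Rightarrow> ('a, 'n) chart \<Rightarrow> bool" where
  "compatible_chart Z \<A> C \<longleftrightarrow>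
     is_chart Z C \<and> (\<forall>C'\<in>\<A>. transition_holo C C' \<and> transition_holo C' C)"

text \<open>The dimension is the number of elements of the index type of \<open>complex^'n\<close>.\<close>

definition complex_manifold :: "'a topology \<Rightarrow> ('a, 'n::finite) chart set \<Rightarrow> bool" where
  "complex_manifold Z \<A> \<longleftrightarrow>
     Hausdorff_space Z \<and> second_countable Z \<and>
     (\<Union>C\<in>\<A>. fst C) = topspace Z \<and> (\<forall>C\<in>\<A>. compatible_chart Z \<A> C)"

definition holo_fun_on ::
    "('a, 'n::finite) chart set \<Rightarrow> 'a set \<Rightarrow> ('a \<Rightarrow> complex) \<Rightarrow> bool" where
  "holo_fun_on \<A> U g \<longleftrightarrow> (\<forall>(V, \<phi>)\<in>\<A>. holo_on (\<phi> ` (U \<inter> V)) (g \<circ> inv_into V \<phi>))"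

text \<open>The field \<open>trivs\<close> contains pairs \<open>(U, \<tau>)\<close> for which \<open>v \<mapsto> (proj v, \<tau> v)\<close> is a local
  trivialization over \<open>U\<close>. The complex structure of the total space is the one determined by the
  local trivializations, so it is not recorded separately.\<close>

record ('a, 'l) line_bundle =
  total :: "'l set"
  proj :: "'l \<Rightarrow> 'a"
  zero_vec :: "'a \<Rightarrow> 'l"
  add_vec :: "'l \<Rightarrow> 'l \<Rightarrow> 'l"
  scale_vec :: "complex \<Rightarrow> 'l \<Rightarrow> 'l"
  trivs :: "('a set \<times> ('l \<Rightarrow> complex)) set"

definition fibre :: "('a, 'l) line_bundle \<Rightarrow> 'a \<Rightarrow> 'l set" where
  "fibre L z = {v \<in> total L. proj L v = z}"

text \<open>The vector space axioms in the fibres follow from the existence of the linear bijections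
  \<open>\<tau>\<close> of the fibres onto \<open>\<complex>\<close>. The function in the last clause is the transition function
  between the trivializations \<open>\<tau>\<close> and \<open>\<tau>'\<close>.\<close>

definition holomorphic_line_bundle ::
    "'a topology \<Rightarrow> ('a, 'n::finite) chart set \<Rightarrow> ('a, 'l) line_bundle \<Rightarrow> bool" where
  "holomorphic_line_bundle Z \<A> L \<longleftrightarrow>
     proj L ` total L \<subseteq> topspace Z \<and>
     (\<forall>z\<in>topspace Z. zero_vec L z \<in> fibre L z \<and>
        (\<forall>v\<in>fibre L z. (\<forall>w\<in>fibre L z. add_vec L v w \<in> fibre L z) \<and>
                       (\<forall>c. scale_vec L c v \<in> fibre L z))) \<and>
     (\<Union>T\<in>trivs L. fst T) = topspace Z \<and>
     (\<forall>(U, \<tau>)\<in>trivs L. openin Z U \<and>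
        (\<forall>z\<in>U. bij_betw \<tau> (fibre L z) UNIV \<and> \<tau> (zero_vec L z) = 0 \<and>
           (\<forall>v\<in>fibre L z. (\<forall>w\<in>fibre L z. \<tau> (add_vec L v w) = \<tau> v + \<tau> w) \<and>
                          (\<forall>c. \<tau> (scale_vec L c v) = c * \<tau> v)))) \<and>
     (\<forall>(U, \<tau>)\<in>trivs L. \<forall>(U', \<tau>')\<in>trivs L.
        holo_fun_on \<A> (U \<inter> U') (\<lambda>z. \<tau>' (inv_into (fibre L z) \<tau> 1)))"

definition holomorphic_section ::
    "'a topology \<Rightarrow> ('a, 'n::finite) chart set \<Rightarrow> ('a, 'l) line_bundle \<Rightarrow> ('a \<Rightarrow> 'l) \<Rightarrow> bool" where
  "holomorphic_section Z \<A> L p \<longleftrightarrow>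
     (\<forall>z\<in>topspace Z. p z \<in> fibre L z) \<and> (\<forall>(U, \<tau>)\<in>trivs L. holo_fun_on \<A> U (\<lambda>z. \<tau> (p z)))"


section \<open>The projective line\<close>

text \<open>Points of \<open>\<bbbP>\<^sup>1\<close> are the lines in \<open>\<complex>\<^sup>2\<close>; \<open>P1_pt t s\<close> is \<open>[t:s]\<close>.\<close>

definition P1_pt :: "complex \<Rightarrow> complex \<Rightarrow> (complex \<times> complex) set" where
  "P1_pt t s = {(c * t, c * s) | c. True}"

definition P1_set :: "(complex \<times> complex) set set" where
  "P1_set = {P1_pt t s | t s. (t, s) \<noteq> (0, 0)}"

text \<open>The quotient topology from \<open>\<complex>\<^sup>2 - {0}\<close>.\<close>

definition P1 :: "(complex \<times> complex) set topology" where
  "P1 = topology (\<lambda>U. U \<subseteq> P1_set \<and> open {v. v \<noteq> (0, 0) \<and> P1_pt (fst v) (snd v) \<in> U})"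

lemma openin_P1:
  "openin P1 U \<longleftrightarrow> U \<subseteq> P1_set \<and> open {v. v \<noteq> (0, 0) \<and> P1_pt (fst v) (snd v) \<in> U}"
proof -
  let ?O = "\<lambda>U. {v. v \<noteq> (0, 0) \<and> P1_pt (fst v) (snd v) \<in> U}"
  have "istopology (\<lambda>U. U \<subseteq> P1_set \<and> open (?O U))"
    unfolding istopology_def
  proof (intro conjI allI impI)
    fix S T assume *: "S \<subseteq> P1_set \<and> open (?O S)" "T \<subseteq> P1_set \<and> open (?O T)"
    then show "S \<inter> T \<subseteq> P1_set" by blast
    have "?O (S \<inter> T) = ?O S \<inter> ?O T" by auto
    then show "open (?O (S \<inter> T))" using * by (simp only: open_Int)
  next
    fix K assume *: "\<forall>S\<in>K. S \<subseteq> P1_set \<and> open (?O S)"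
    then show "\<Union>K \<subseteq> P1_set" by blast
    have "?O (\<Union>K) = (\<Union>S\<in>K. ?O S)" by auto
    moreover have "open (\<Union>S\<in>K. ?O S)" using * by (intro open_UN) blast
    ultimately show "open (?O (\<Union>K))" by simp
  qed
  then show ?thesis unfolding P1_def by simp
qed

lemma topspace_P1: "topspace P1 = P1_set"
proof -
  have "{v :: complex \<times> complex. v \<noteq> (0, 0) \<and> P1_pt (fst v) (snd v) \<in> P1_set} = - {(0, 0)}"
    by (force simp: P1_set_def)
  then have "openin P1 P1_set" by (simp add: openin_P1 open_Compl)
  then show ?thesis by (meson openin_P1 openin_subset openin_topspace subset_antisym)
qed

text \<open>The inclusion \<open>\<complex> \<subset> \<bbbP>\<^sup>1\<close>; the point at infinity is \<open>[1:0] = P1_pt 1 0\<close>.\<close>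

definition aff :: "complex \<Rightarrow> (complex \<times> complex) set" where
  "aff w = P1_pt w 1"

definition aff_inf :: "complex \<Rightarrow> (complex \<times> complex) set" where
  "aff_inf w = P1_pt 1 w"

definition vec_snoc :: "complex^'n::finite \<Rightarrow> complex \<Rightarrow> complex^('n option)" where
  "vec_snoc v c = (\<chi> i. case i of None \<Rightarrow> c | Some j \<Rightarrow> v $ j)"

text \<open>The atlas of the product with \<open>\<bbbP>\<^sup>1\<close> obtained from the two standard charts of \<open>\<bbbP>\<^sup>1\<close>.\<close>

definition prod_P1_atlas ::
    "('a, 'n::finite) chart set \<Rightarrow> ('a \<times> (complex \<times> complex) set, 'n option) chart set" where
  "prod_P1_atlas \<A> =
     {(U \<times> range g, \<lambda>(z, l). vec_snoc (\<phi> z) (inv_into UNIV g l)) | U \<phi> g. (U, \<phi>) \<in> \<A> \<and> g \<in> {aff, aff_inf}}"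


section \<open>Meromorphic functions\<close>

text \<open>A pair of germs of holomorphic functions at \<open>x\<close> is treated through arbitrary
  representatives on a neighbourhood \<open>Z\<close> of \<open>x\<close>. Holomorphic functions on \<open>Z\<close> are the sections
  of a line bundle with a fixed trivialization over all of \<open>Z\<close>; this makes the local
  and the global setting instances of the same data.\<close>

definition local_setting ::
    "'a topology \<Rightarrow> ('a, 'n::finite) chart set \<Rightarrow> 'a \<Rightarrow> ('a, 'l) line_bundle
      \<Rightarrow> ('a \<Rightarrow> 'l) \<Rightarrow> ('a \<Rightarrow> 'l) \<Rightarrow> bool" where
  "local_setting Z \<A> x L p q \<longleftrightarrow>
     complex_manifold Z \<A> \<and> x \<in> topspace Z \<and>
     holomorphic_line_bundle Z \<A> L \<and> (\<exists>\<tau>. (topspace Z, \<tau>) \<in> trivs L) \<and>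
     holomorphic_section Z \<A> L p \<and> holomorphic_section Z \<A> L q \<and>
     \<not> (\<exists>U. openin Z U \<and> x \<in> U \<and> (\<forall>z\<in>U. q z = zero_vec L z))"

definition global_setting ::
    "'a topology \<Rightarrow> ('a, 'n::finite) chart set \<Rightarrow> ('a, 'l) line_bundle
      \<Rightarrow> ('a \<Rightarrow> 'l) \<Rightarrow> ('a \<Rightarrow> 'l) \<Rightarrow> bool" where
  "global_setting Z \<A> L p q \<longleftrightarrow>
     complex_manifold Z \<A> \<and> connected_space Z \<and> compact_space Z \<and>
     holomorphic_line_bundle Z \<A> L \<and>
     holomorphic_section Z \<A> L p \<and> holomorphic_section Z \<A> L q \<and>
     (\<exists>z\<in>topspace Z. q z \<noteq> zero_vec L z)"

definition pole_complement :: "'a topology \<Rightarrow> ('a, 'l) line_bundle \<Rightarrow> ('a \<Rightarrow> 'l) \<Rightarrow> 'a topology" where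
  "pole_complement Z L q = subtopology Z {z. q z \<noteq> zero_vec L z}"

definition quotient_fun :: "('a, 'l) line_bundle \<Rightarrow> ('a \<Rightarrow> 'l) \<Rightarrow> ('a \<Rightarrow> 'l) \<Rightarrow> 'a \<Rightarrow> complex" where
  "quotient_fun L p q z = (THE c. p z = scale_vec L c (q z))"

definition completed_set ::
    "'a topology \<Rightarrow> ('a, 'l) line_bundle \<Rightarrow> ('a \<Rightarrow> 'l) \<Rightarrow> ('a \<Rightarrow> 'l)
      \<Rightarrow> ('a \<times> (complex \<times> complex) set) set" where
  "completed_set Z L p q =
     {(z, P1_pt t s) | z t s. z \<in> topspace Z \<and> (t, s) \<noteq> (0, 0) \<and>
        add_vec L (scale_vec L s (p z)) (scale_vec L (- t) (q z)) = zero_vec L z}"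

definition P1_graph :: "'a topology \<Rightarrow> ('a \<Rightarrow> complex) \<Rightarrow> ('a \<times> (complex \<times> complex) set) set" where
  "P1_graph X f = {(z, aff (f z)) | z. z \<in> topspace X}"


section \<open>Whitney stratifications\<close>

definition complex_submanifold ::
    "'m topology \<Rightarrow> ('m, 'k::finite) chart set \<Rightarrow> nat \<Rightarrow> 'm set \<Rightarrow> bool" where
  "complex_submanifold M \<A> d S \<longleftrightarrow>
     S \<subseteq> topspace M \<and>
     (\<forall>x\<in>S. \<exists>U \<phi> V. x \<in> U \<and> compatible_chart M \<A> (U, \<phi>) \<and>
        vec.subspace V \<and> vec.dim V = d \<and> \<phi> ` (U \<inter> S) = \<phi> ` U \<inter> V)"

text \<open>Velocities at \<open>x\<close> of curves in \<open>S\<close>.\<close>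

definition tangent_space :: "'e::real_normed_vector set \<Rightarrow> 'e \<Rightarrow> 'e set" where
  "tangent_space S x =
     {v. \<exists>c. c 0 = x \<and> eventually (\<lambda>t::real. c t \<in> S) (nhds 0) \<and>
             (c has_vector_derivative v) (at 0)}"

text \<open>Convergence in a Grassmannian: for subspaces of equal dimension it suffices that every
  vector of the limit is a limit of vectors of the sequence.\<close>

definition subspaces_tendsto :: "(nat \<Rightarrow> 'e::euclidean_space set) \<Rightarrow> 'e set \<Rightarrow> bool" where
  "subspaces_tendsto T \<tau> \<longleftrightarrow>
     subspace \<tau> \<and> (\<forall>k. subspace (T k) \<and> dim (T k) = dim \<tau>) \<and>
     (\<forall>v\<in>\<tau>. \<exists>u. (\<forall>k. u k \<in> T k) \<and> u \<longlonglongrightarrow> v)"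

text \<open>Whitney's conditions (a) and (b) for the larger stratum \<open>B\<close> along the smaller stratum \<open>A\<close>.
  \<open>sgn\<close> normalizes the secant vectors.\<close>

definition whitney_regular ::
    "('m, 'k::finite) chart set \<Rightarrow> 'm set \<Rightarrow> 'm set \<Rightarrow> bool" where
  "whitney_regular \<A> B A \<longleftrightarrow>
     (\<forall>(U, \<phi>)\<in>\<A>. \<forall>y\<in>A \<inter> U. \<forall>b \<tau>.
        (\<forall>k. b k \<in> B \<inter> U) \<longrightarrow> (\<lambda>k. \<phi> (b k)) \<longlonglongrightarrow> \<phi> y \<longrightarrow>
        subspaces_tendsto (\<lambda>k. tangent_space (\<phi> ` (B \<inter> U)) (\<phi> (b k))) \<tau> \<longrightarrow>
          tangent_space (\<phi> ` (A \<inter> U)) (\<phi> y) \<subseteq> \<tau> \<and>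
          (\<forall>a v. (\<forall>k. a k \<in> A \<inter> U \<and> a k \<noteq> b k) \<longrightarrow> (\<lambda>k. \<phi> (a k)) \<longlonglongrightarrow> \<phi> y \<longrightarrow>
             (\<lambda>k. sgn (\<phi> (b k) - \<phi> (a k))) \<longlonglongrightarrow> v \<longrightarrow> v \<in> \<tau>))"

definition whitney_stratification ::
    "'m topology \<Rightarrow> ('m, 'k::finite) chart set \<Rightarrow> 'm set \<Rightarrow> 'm set set \<Rightarrow> bool" where
  "whitney_stratification M \<A> S \<W> \<longleftrightarrow>
     \<Union>\<W> = S \<and> {} \<notin> \<W> \<and> disjoint \<W> \<and>
     (\<forall>x\<in>S. \<exists>N. openin M N \<and> x \<in> N \<and> finite {A \<in> \<W>. A \<inter> N \<noteq> {}}) \<and>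
     (\<forall>A\<in>\<W>. \<exists>d. complex_submanifold M \<A> d A) \<and>
     (\<forall>A\<in>\<W>. \<forall>B\<in>\<W>. A \<inter> M closure_of B \<noteq> {} \<longrightarrow> A \<subseteq> M closure_of B) \<and>
     (\<forall>A\<in>\<W>. \<forall>B\<in>\<W>. A \<noteq> B \<longrightarrow> whitney_regular \<A> B A)"


section \<open>Atypical values\<close>

text \<open>Stratified topological triviality near \<open>c\<close> of the projection to \<open>\<bbbP>\<^sup>1\<close> restricted to a
  subset \<open>S\<close> of the product of \<open>Z\<close> with \<open>\<bbbP>\<^sup>1\<close>, stratified by \<open>\<W>\<close>.\<close>

definition strat_trivial_at ::
    "'a topology \<Rightarrow> ('a \<times> (complex \<times> complex) set) set \<Rightarrow> ('a \<times> (complex \<times> complex) set) set set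
      \<Rightarrow> (complex \<times> complex) set \<Rightarrow> bool" where
  "strat_trivial_at Z S \<W> c \<longleftrightarrow>
     (\<exists>U h. openin P1 U \<and> c \<in> U \<and>
        homeomorphic_map (subtopology (prod_topology Z P1) (S \<inter> snd -` U))
          (prod_topology (subtopology P1 U) (subtopology (prod_topology Z P1) (S \<inter> snd -` {c}))) h \<and>
        (\<forall>x\<in>S \<inter> snd -` U. fst (h x) = snd x) \<and>
        (\<forall>A\<in>\<W>. h ` (A \<inter> snd -` U) = U \<times> (A \<inter> snd -` {c})))"

definition atypical_set ::
    "'a topology \<Rightarrow> ('a \<times> (complex \<times> complex) set) set \<Rightarrow> ('a \<times> (complex \<times> complex) set) set set
      \<Rightarrow> (complex \<times> complex) set set" where
  "atypical_set Z S \<W> = (LEAST B. B \<subseteq> P1_set \<and> (\<forall>c\<in>P1_set - B. strat_trivial_at Z S \<W> c))"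

lemma atypical_set_eq: "atypical_set Z S \<W> = {c \<in> P1_set. \<not> strat_trivial_at Z S \<W> c}"
  unfolding atypical_set_def by (rule Least_equality) auto


section \<open>Paths, direct sum decomposition and monodromy\<close>

definition tube :: "'a topology \<Rightarrow> ('a \<Rightarrow> complex) \<Rightarrow> complex set \<Rightarrow> 'a set" where
  "tube X f A = {x \<in> topspace X. f x \<in> A}"

text \<open>\<open>\<Lambda>\<close> is the set of atypical values in \<open>\<complex>\<close>, \<open>cball c R\<close> the big disc, \<open>cball a (r a)\<close> the
  small disc at \<open>a\<close>, and \<open>\<gamma> a\<close> the path from \<open>s\<close> to the base point \<open>pathfinish (\<gamma> a)\<close> on its boundary.
  The paths avoid \<open>\<Lambda>\<close>, as needed for the transport of fibres.\<close>

definition path_system ::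
    "complex set \<Rightarrow> complex \<Rightarrow> real \<Rightarrow> complex \<Rightarrow> (complex \<Rightarrow> real)
      \<Rightarrow> (complex \<Rightarrow> real \<Rightarrow> complex) \<Rightarrow> bool" where
  "path_system \<Lambda> c R s r \<gamma> \<longleftrightarrow>
     0 < R \<and> \<Lambda> \<subseteq> cball c R \<and> s \<in> sphere c R \<and>
     (\<forall>a\<in>\<Lambda>. 0 < r a \<and> cball a (r a) \<subseteq> cball c R \<and> cball a (r a) \<inter> \<Lambda> = {a} \<and>
        arc (\<gamma> a) \<and> path_image (\<gamma> a) \<subseteq> cball c R - \<Lambda> \<and>
        pathstart (\<gamma> a) = s \<and> pathfinish (\<gamma> a) \<in> sphere a (r a)) \<and>
     (\<forall>a\<in>\<Lambda>. \<forall>b\<in>\<Lambda>. a \<noteq> b \<longrightarrow> path_image (\<gamma> a) \<inter> path_image (\<gamma> b) = {s})"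

text \<open>The homology group of the pair of the tube over the small disc at \<open>a\<close> and the fibre over
  the base point on its boundary.\<close>

definition local_homology ::
    "int \<Rightarrow> 'a topology \<Rightarrow> ('a \<Rightarrow> complex) \<Rightarrow> (complex \<Rightarrow> real) \<Rightarrow> (complex \<Rightarrow> real \<Rightarrow> complex)
      \<Rightarrow> complex \<Rightarrow> 'a chain set monoid" where
  "local_homology k X f r \<gamma> a =
     relative_homology_group k (subtopology X (tube X f (cball a (r a))))
       (tube X f {pathfinish (\<gamma> a)})"

text \<open>Inclusion of pairs followed by transport along \<open>g = \<gamma> a\<close>: since \<open>f\<close> is a locally trivial
  fibration over the arc \<open>g\<close>, inclusion induces an isomorphism from the homology of \<open>X\<close> relative to
  the fibre over \<open>pathstart g\<close> to that relative to \<open>f\<^sup>-\<^sup>1(g)\<close>, and similarly for \<open>pathfinish g\<close>.\<close>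

definition transport_hom ::
    "int \<Rightarrow> 'a topology \<Rightarrow> ('a \<Rightarrow> complex) \<Rightarrow> (real \<Rightarrow> complex) \<Rightarrow> 'a chain set \<Rightarrow> 'a chain set" where
  "transport_hom k X f g =
     inv_into (carrier (relative_homology_group k X (tube X f {pathstart g})))
       (hom_induced k X (tube X f {pathstart g}) X (tube X f (path_image g)) id) \<circ>
     hom_induced k X (tube X f {pathfinish g}) X (tube X f (path_image g)) id"

definition summand_hom ::
    "int \<Rightarrow> 'a topology \<Rightarrow> ('a \<Rightarrow> complex) \<Rightarrow> (complex \<Rightarrow> real) \<Rightarrow> (complex \<Rightarrow> real \<Rightarrow> complex)
      \<Rightarrow> complex \<Rightarrow> 'a chain set \<Rightarrow> 'a chain set" where
  "summand_hom k X f r \<gamma> a =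
     transport_hom k X f (\<gamma> a) \<circ>
     hom_induced k (subtopology X (tube X f (cball a (r a)))) (tube X f {pathfinish (\<gamma> a)})
       X (tube X f {pathfinish (\<gamma> a)}) id"

text \<open>The map from \<open>sum_group \<Lambda> (local_homology k X f r \<gamma>)\<close> to the homology of \<open>X\<close> relative to the
  fibre over \<open>s\<close>, by which the two groups are identified.\<close>

definition direct_sum_hom ::
    "int \<Rightarrow> 'a topology \<Rightarrow> ('a \<Rightarrow> complex) \<Rightarrow> complex set \<Rightarrow> complex \<Rightarrow> (complex \<Rightarrow> real)
      \<Rightarrow> (complex \<Rightarrow> real \<Rightarrow> complex) \<Rightarrow> (complex \<Rightarrow> 'a chain set) \<Rightarrow> 'a chain set" where
  "direct_sum_hom k X f \<Lambda> s r \<gamma> =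
     (\<lambda>u. \<Otimes>\<^bsub>relative_homology_group k X (tube X f {s})\<^esub>a\<in>\<Lambda>. summand_hom k X f r \<gamma> a (u a))"

definition single :: "'i set \<Rightarrow> ('i \<Rightarrow> ('b, 'c) monoid_scheme) \<Rightarrow> 'i \<Rightarrow> 'b \<Rightarrow> 'i \<Rightarrow> 'b" where
  "single I G i x = (\<lambda>j\<in>I. if j = i then x else \<one>\<^bsub>G j\<^esub>)"

text \<open>Joint continuity of the inverses is part of the definition.\<close>

definition isotopy :: "'b topology \<Rightarrow> (real \<Rightarrow> 'b \<Rightarrow> 'b) \<Rightarrow> bool" where
  "isotopy Y H \<longleftrightarrow>
     homeomorphic_map (prod_topology (top_of_set {0..1}) Y) (prod_topology (top_of_set {0..1}) Y)
       (\<lambda>(t, y). (t, H t y)) \<and>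
     (\<forall>y\<in>topspace Y. H 0 y = y)"

text \<open>Counterclockwise loop around \<open>a\<close>, based at \<open>pathstart g\<close> through \<open>g\<close>.\<close>

definition monodromy_loop :: "complex \<Rightarrow> (real \<Rightarrow> complex) \<Rightarrow> real \<Rightarrow> complex" where
  "monodromy_loop a g =
     g +++ ((\<lambda>t. a + (pathfinish g - a) * cis (2 * pi * t)) +++ reversepath g)"

text \<open>\<open>H\<close> lifts an isotopy \<open>\<Phi>\<close> of \<open>\<complex>\<close> that is fixed near \<open>\<Lambda>P \<subseteq> \<bbbP>\<^sup>1\<close> and moves the base point along
  the loop around \<open>a\<close>. The monodromy is the end map \<open>H 1\<close>, which sends the fibre over the base point
  to itself.\<close>

definition monodromy_isotopy ::
    "'a topology \<Rightarrow> ('a \<Rightarrow> complex) \<Rightarrow> (complex \<times> complex) set set \<Rightarrow> complex \<Rightarrow> (real \<Rightarrow> complex)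
      \<Rightarrow> (real \<Rightarrow> complex \<Rightarrow> complex) \<Rightarrow> (real \<Rightarrow> 'a \<Rightarrow> 'a) \<Rightarrow> bool" where
  "monodromy_isotopy X f \<Lambda>P a g \<Phi> H \<longleftrightarrow>
     isotopy euclidean \<Phi> \<and>
     (\<forall>t\<in>{0..1}. \<Phi> t (pathstart g) = monodromy_loop a g t) \<and>
     (\<exists>N. openin P1 N \<and> \<Lambda>P \<subseteq> N \<and> (\<forall>w. aff w \<in> N \<longrightarrow> (\<forall>t\<in>{0..1}. \<Phi> t w = w))) \<and>
     isotopy X H \<and>
     (\<forall>t\<in>{0..1}. \<forall>y\<in>topspace X. f (H t y) = \<Phi> t (f y))"

end

theory Submission
  imports Defs
begin

text \<open>Let \<open>g = \<gamma> a\<close>, \<open>A = f\<^sup>-\<^sup>1(g)\<close>, let \<open>D\<close> be the tube over the small disc at \<open>a\<close>, and let \<open>B\<close> be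
  the fibre over the end point of \<open>g\<close>. While the base point runs along \<open>g\<close> (in either direction),
  the isotopy \<open>H\<close> keeps the image of \<open>F\<close> inside \<open>A\<close>; while it runs around the circle, the image
  stays inside \<open>D\<close>. If the circle is traversed from time \<open>u\<close> to time \<open>v\<close>, then \<open>T \<omega> - \<omega>\<close> and
  \<open>H\<^sub>v \<omega> - H\<^sub>u \<omega>\<close> agree in the homology of \<open>(X, A)\<close>, and the latter class, which lives in that of
  \<open>(X, B)\<close>, dies in that of \<open>(X, D)\<close>. By the exact sequence of the triple \<open>(X, D, B)\<close> it comes from
  \<open>(D, B)\<close>. The inclusion of \<open>(X, F)\<close> into \<open>(X, A)\<close> is injective on homology because \<open>H\<close> itself
  trivializes \<open>f\<close> over \<open>g\<close>.\<close>

section \<open>Continuity of the quotient of two sections off the zeros of the denominator\<close>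

lemma holo_on_imp_continuous_on: "holo_on S g \<Longrightarrow> continuous_on S g"
  unfolding holo_on_def
  by (meson continuous_at_imp_continuous_at_within continuous_on_eq_continuous_within
      has_derivative_continuous)

text \<open>On a chart domain \<open>g\<close> is the composite of
  \<open>g \<circ> inv_into V \<phi>\<close>, continuous because holomorphic, with the chart
  \<open>\<phi>\<close>. The chart domains are open and cover \<open>U\<close>, so the pasting lemma
  applies.\<close>

lemma holo_fun_on_imp_continuous_map:
  assumes M: "complex_manifold Z \<A>" and U: "U \<subseteq> topspace Z" and g: "holo_fun_on \<A> U g"
  shows "continuous_map (subtopology Z U) euclidean g"
proof (rule pasting_lemma[where I = \<A> and T = "\<lambda>C. U \<inter> fst C" and f = "\<lambda>_. g"])
  fix C assume C: "C \<in> \<A>"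
  obtain V \<phi> where VC: "C = (V, \<phi>)" by (cases C)
  have chart: "is_chart Z (V, \<phi>)"
    using M C VC unfolding complex_manifold_def compatible_chart_def by blast
  then have opV: "openin Z V" and hom: "homeomorphic_map (subtopology Z V) (top_of_set (\<phi> ` V)) \<phi>"
    unfolding is_chart_def by auto
  show "openin (subtopology Z U) (U \<inter> fst C)"
    using opV VC by (simp add: openin_subtopology_Int2)
  have inj: "inj_on \<phi> V"
    using hom openin_subset[OF opV]
    by (simp add: homeomorphic_eq_everything_map Int_absorb1)
  have "continuous_on (\<phi> ` (U \<inter> V)) (g \<circ> inv_into V \<phi>)"
    using g C VC unfolding holo_fun_on_def by (blast intro: holo_on_imp_continuous_on)
  then have "continuous_map (top_of_set (\<phi> ` (U \<inter> V))) euclidean (g \<circ> inv_into V \<phi>)"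
    by simp
  moreover have "continuous_map (subtopology Z (U \<inter> V)) (top_of_set (\<phi> ` (U \<inter> V))) \<phi>"
    using continuous_map_from_subtopology[OF homeomorphic_imp_continuous_map[OF hom], of "U \<inter> V"]
    by (auto simp: continuous_map_in_subtopology subtopology_subtopology inf.left_commute Int_absorb)
  ultimately have "continuous_map (subtopology Z (U \<inter> V)) euclidean ((g \<circ> inv_into V \<phi>) \<circ> \<phi>)"
    by (rule continuous_map_compose[rotated])
  then have "continuous_map (subtopology Z (U \<inter> V)) euclidean g"
    by (rule continuous_map_eq) (use inj in auto)
  then show "continuous_map (subtopology (subtopology Z U) (U \<inter> fst C)) euclidean g"
    by (simp add: subtopology_subtopology VC)
next
  fix x assume x: "x \<in> topspace (subtopology Z U)"
  then have "x \<in> (\<Union>C\<in>\<A>. fst C)"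
    using M by (simp add: complex_manifold_def)
  with x show "\<exists>C. C \<in> \<A> \<and> x \<in> U \<inter> fst C \<and> g x = g x"
    by auto
qed auto

text \<open>Since \<open>\<tau>\<close> is linear and injective on the fibre, the equation defining
  the quotient becomes a scalar equation with nonzero coefficient \<open>\<tau> (q z)\<close>. Its
  solution is unique, so the description operator in \<open>quotient_fun\<close> is well
  defined.\<close>

lemma quotient_fun_trivialization:
  assumes L: "holomorphic_line_bundle Z \<A> L" and T: "(U, \<tau>) \<in> trivs L" and z: "z \<in> U"
    and p: "p z \<in> fibre L z" and q: "q z \<in> fibre L z" and nz: "q z \<noteq> zero_vec L z"
  shows "\<tau> (q z) \<noteq> 0" "quotient_fun L p q z = \<tau> (p z) / \<tau> (q z)"
proof -
  have UZ: "U \<subseteq> topspace Z"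
    using L T unfolding holomorphic_line_bundle_def by (auto dest!: openin_subset)
  have bij: "bij_betw \<tau> (fibre L z) UNIV" and zero: "\<tau> (zero_vec L z) = 0"
    and scale: "\<And>v c. v \<in> fibre L z \<Longrightarrow> \<tau> (scale_vec L c v) = c * \<tau> v"
    using L T z unfolding holomorphic_line_bundle_def by fast+
  have mem: "zero_vec L z \<in> fibre L z" "\<And>v c. v \<in> fibre L z \<Longrightarrow> scale_vec L c v \<in> fibre L z"
    using L UZ z unfolding holomorphic_line_bundle_def by fast+
  have inj: "inj_on \<tau> (fibre L z)"
    using bij bij_betw_def by blast
  show nz': "\<tau> (q z) \<noteq> 0"
    using inj_onD[OF inj] mem q nz zero by metis
  have "p z = scale_vec L c (q z) \<longleftrightarrow> c = \<tau> (p z) / \<tau> (q z)" for c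
    using inj_on_eq_iff[OF inj p mem(2)[OF q], of c] scale[OF q, of c] nz'
    by (metis eq_divide_eq)
  then show "quotient_fun L p q z = \<tau> (p z) / \<tau> (q z)"
    unfolding quotient_fun_def by simp
qed

text \<open>Over each trivializing open set the quotient is a ratio of continuous functions with
  nonvanishing denominator; these sets cover the space.\<close>

lemma continuous_map_quotient_fun:
  assumes M: "complex_manifold Z \<A>" and L: "holomorphic_line_bundle Z \<A> L"
    and p: "holomorphic_section Z \<A> L p" and q: "holomorphic_section Z \<A> L q"
  shows "continuous_map (pole_complement Z L q) euclidean (quotient_fun L p q)"
proof -
  let ?N = "{z. q z \<noteq> zero_vec L z}"
  have fib: "p z \<in> fibre L z" "q z \<in> fibre L z" if "z \<in> topspace Z" for z
    using p q that unfolding holomorphic_section_def by auto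
  show ?thesis
    unfolding pole_complement_def
  proof (rule pasting_lemma[where I = "trivs L" and T = "\<lambda>C. ?N \<inter> fst C"
          and f = "\<lambda>_. quotient_fun L p q"])
    fix C assume C: "C \<in> trivs L"
    obtain U \<tau> where UC: "C = (U, \<tau>)" by (cases C)
    have T: "(U, \<tau>) \<in> trivs L" using C UC by simp
    have opU: "openin Z U"
      using L T unfolding holomorphic_line_bundle_def by auto
    then have UZ: "U \<subseteq> topspace Z" by (rule openin_subset)
    show "openin (subtopology Z ?N) (?N \<inter> fst C)"
      using opU UC by (simp add: openin_subtopology_Int2)
    have "continuous_map (subtopology Z U) euclidean (\<lambda>z. \<tau> (p z))"
      "continuous_map (subtopology Z U) euclidean (\<lambda>z. \<tau> (q z))"
      using p q T by (auto simp: holomorphic_section_def intro!: holo_fun_on_imp_continuous_map[OF M UZ])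
    then have "continuous_map (subtopology Z (?N \<inter> U)) euclidean (\<lambda>z. \<tau> (p z))"
      "continuous_map (subtopology Z (?N \<inter> U)) euclidean (\<lambda>z. \<tau> (q z))"
      using continuous_map_from_subtopology_mono by blast+
    then have "continuous_map (subtopology Z (?N \<inter> U)) euclidean (\<lambda>z. \<tau> (p z) / \<tau> (q z))"
      using quotient_fun_trivialization(1)[OF L T, where p = p and q = q, OF _ fib]
      by (auto simp: continuous_map_atin intro!: tendsto_divide)
    then have "continuous_map (subtopology Z (?N \<inter> U)) euclidean (quotient_fun L p q)"
      by (rule continuous_map_eq)
        (use quotient_fun_trivialization(2)[OF L T] fib UZ in auto)
    then show "continuous_map (subtopology (subtopology Z ?N) (?N \<inter> fst C)) euclidean (quotient_fun L p q)"
      by (simp add: subtopology_subtopology UC)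
  next
    fix z assume z: "z \<in> topspace (subtopology Z ?N)"
    then have "z \<in> (\<Union>C\<in>trivs L. fst C)"
      using L by (simp add: holomorphic_line_bundle_def)
    with z show "\<exists>C. C \<in> trivs L \<and> z \<in> ?N \<inter> fst C \<and> quotient_fun L p q z = quotient_fun L p q z"
      by auto
  qed auto
qed

section \<open>Inclusion of the affine line; isotopies and their action on homology\<close>

lemma aff_eq_iff: "aff w = aff w' \<longleftrightarrow> w = w'"
proof
  assume "aff w = aff w'"
  \<comment> \<open>The second coordinate 1 of this vector forces the scalar 1 in its representation
    as a point of \<open>aff w'\<close>.\<close>
  moreover have "(w, 1) \<in> aff w" unfolding aff_def P1_pt_def by force
  ultimately show "w = w'" unfolding aff_def P1_pt_def by force
qed simp

lemma isotopy_continuous_map: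
  assumes "isotopy Y H"
  shows "continuous_map (prod_topology (top_of_set {0..1}) Y) Y (\<lambda>(t, y). H t y)"
  using continuous_map_compose[OF homeomorphic_imp_continuous_map continuous_map_snd,
      OF conjunct1[OF assms[unfolded isotopy_def]]]
  by (simp add: o_def case_prod_unfold)

text \<open>The homeomorphism \<open>(t, y) \<mapsto> (t, H t y)\<close> is inverted as a whole, and
  \<open>K\<close> is the second component of the inverse. This makes \<open>K\<close> jointly
  continuous in time and space.\<close>

lemma isotopy_inverse:
  assumes "isotopy Y H"
  obtains K where "continuous_map (prod_topology (top_of_set {0..1}) Y) Y (\<lambda>(t, y). K t y)"
    and "\<And>t y. t \<in> {0..1} \<Longrightarrow> y \<in> topspace Y \<Longrightarrow> K t (H t y) = y"
    and "\<And>t y. t \<in> {0..1} \<Longrightarrow> y \<in> topspace Y \<Longrightarrow> H t (K t y) = y"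
proof -
  let ?P = "prod_topology (top_of_set {0..1::real}) Y"
  obtain G where G: "homeomorphic_maps ?P ?P (\<lambda>(t, y). (t, H t y)) G"
    using assms unfolding isotopy_def homeomorphic_map_maps by blast
  let ?K = "\<lambda>t y. snd (G (t, y))"
  show thesis
  proof
    show "continuous_map ?P Y (\<lambda>(t, y). ?K t y)"
      using G continuous_map_compose[of ?P ?P G Y snd] continuous_map_snd
      by (fastforce simp: homeomorphic_maps_def o_def case_prod_unfold)
    fix t :: real and y assume ty: "t \<in> {0..1}" "y \<in> topspace Y"
    show "?K t (H t y) = y"
      using G ty by (fastforce simp: homeomorphic_maps_def)
    \<comment> \<open>The first components show that \<open>G\<close> preserves the time; the second
      ones then give the claim.\<close>
    have "(\<lambda>(t, y). (t, H t y)) (G (t, y)) = (t, y)"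
      using G ty by (fastforce simp: homeomorphic_maps_def)
    then show "H t (?K t y) = y"
      by (auto simp: case_prod_unfold)
  qed
qed

text \<open>Reparametrized affinely from \<open>{0..1}\<close> to \<open>{u..v}\<close>, the isotopy
  is a homotopy through maps of pairs from \<open>(X, S)\<close> to \<open>(X, T)\<close>.\<close>

lemma isotopy_hom_induced_eq:
  assumes H: "isotopy X H" and uv: "0 \<le> u" "u \<le> v" "v \<le> 1"
    and ST: "\<And>t. t \<in> {u..v} \<Longrightarrow> H t \<in> S \<rightarrow> T"
  shows "hom_induced k X S X T (H u) = hom_induced k X S X T (H v)"
proof (rule homology_homotopy_axiom)
  let ?m = "\<lambda>t. u + t * (v - u)"
  have m: "?m t \<in> {u..v}" if "t \<in> {0..1}" for t
    using that uv mult_left_le_one_le[of "v - u" t] by auto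
  have "continuous_map (top_of_set {0..1}) (top_of_set {0..1}) ?m"
    using m uv by (fastforce simp: continuous_map_in_subtopology intro!: continuous_intros)
  then have "continuous_map (prod_topology (top_of_set {0..1}) X) (prod_topology (top_of_set {0..1}) X)
      (\<lambda>(t, x). (?m t, x))"
    by (rule continuous_map_prod_top[THEN iffD2, OF disjI2, OF conjI]) auto
  from continuous_map_compose[OF this isotopy_continuous_map[OF H]]
  have "continuous_map (prod_topology (top_of_set {0..1}) X) X (\<lambda>(t, x). H (?m t) x)"
    by (simp add: o_def case_prod_unfold)
  then show "homotopic_with (\<lambda>h. h \<in> S \<rightarrow> T) X X (H u) (H v)"
    unfolding homotopic_with_def using ST m
    by (intro exI[of _ "\<lambda>(t, x). H (?m t) x"]) auto
qed

section \<open>From the homology relative to a fibre to that relative to the preimage of an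
  arc\<close>

text \<open>\<open>\<Phi> (m t)\<close> moves the start of \<open>g\<close> to \<open>g t\<close>,
  so the maps \<open>H (m t)\<close> trivialize \<open>f\<close> over the arc. Undoing this motion
  deforms the preimage \<open>A\<close> of the arc into the fibre \<open>F\<close>. Hence
  \<open>(A, F)\<close> maps trivially to \<open>(X, F)\<close> in homology, and the exact sequence
  of the triple \<open>(X, A, F)\<close> gives injectivity.\<close>

lemma isotopy_section_inj_hom_induced:
  assumes f: "continuous_map X euclidean f" and g: "arc g" and H: "isotopy X H"
    and m: "continuous_on {0..1} m" "m \<in> {0..1} \<rightarrow> {0..1}" "m 0 = 0"
    and fH: "\<And>t y. t \<in> {0..1} \<Longrightarrow> y \<in> topspace X \<Longrightarrow> f (H t y) = \<Phi> t (f y)"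
    and inj: "\<And>t. t \<in> {0..1} \<Longrightarrow> inj (\<Phi> t)"
    and \<Phi>: "\<And>t. t \<in> {0..1} \<Longrightarrow> \<Phi> (m t) (pathstart g) = g t"
  shows "inj_on (hom_induced k X (tube X f {pathstart g}) X (tube X f (path_image g)) id)
           (carrier (relative_homology_group k X (tube X f {pathstart g})))"
proof -
  define F where "F = tube X f {pathstart g}"
  define A where "A = tube X f (path_image g)"
  have FA: "F \<subseteq> A"
    by (auto simp: F_def A_def tube_def)
  have A: "A \<subseteq> topspace X"
    by (auto simp: A_def tube_def)
  let ?I = "top_of_set {0..1::real}"
  let ?P = "prod_topology ?I (subtopology X A)"
  obtain h where h: "homeomorphism {0..1} (path_image g) g h"
    using g by (rule homeomorphism_arc)
  obtain K where contK: "continuous_map (prod_topology ?I X) X (\<lambda>(t, y). K t y)"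
    and KH: "\<And>t y. t \<in> {0..1} \<Longrightarrow> y \<in> topspace X \<Longrightarrow> K t (H t y) = y"
    and HK: "\<And>t y. t \<in> {0..1} \<Longrightarrow> y \<in> topspace X \<Longrightarrow> H t (K t y) = y"
    using isotopy_inverse[OF H] by metis
  have Ktop: "K t y \<in> topspace X" if "t \<in> {0..1}" "y \<in> topspace X" for t y
    using continuous_map_image_subset_topspace[OF contK] that by fastforce
  have H0: "H 0 y = y" if "y \<in> topspace X" for y
    using H that by (simp add: isotopy_def)
  \<comment> \<open>\<open>h (f x)\<close> is the parameter on the arc of the point below
    \<open>x\<close>. \<open>K\<close> pulls \<open>x\<close> back to \<open>F\<close>, and
    \<open>H\<close> pushes it forward again along the fraction \<open>1 - t\<close> of the way, so
    \<open>\<rho>\<close> runs from the identity of \<open>A\<close> to a map into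
    \<open>F\<close>.\<close>
  define \<rho> where "\<rho> = (\<lambda>(t, x). H (m ((1 - t) * h (f x))) (K (m (h (f x))) x))"
  have hf: "h (f x) \<in> {0..1}" "g (h (f x)) = f x" "m (h (f x)) \<in> {0..1}" if "x \<in> A" for x
  proof -
    show hfx: "h (f x) \<in> {0..1}" and "g (h (f x)) = f x"
      using that h by (auto simp: A_def tube_def homeomorphism_def)
    show "m (h (f x)) \<in> {0..1}"
      using m(2) hfx by (rule funcset_mem)
  qed
  have K_in: "K (m (h (f x))) x \<in> F" if x: "x \<in> A" for x
  proof -
    have xX: "x \<in> topspace X" using x A by blast
    \<comment> \<open>The value of \<open>f\<close> at the pulled back point and
      \<open>pathstart g\<close> have the same image \<open>f x\<close> under an injective
      map.\<close>
    have "\<Phi> (m (h (f x))) (f (K (m (h (f x))) x)) = f x"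
      using fH[OF hf(3)[OF x] Ktop[OF hf(3)[OF x] xX]] HK[OF hf(3)[OF x] xX] by simp
    also have "\<dots> = \<Phi> (m (h (f x))) (pathstart g)"
      using \<Phi>[OF hf(1)[OF x]] hf(2)[OF x] by simp
    finally have "f (K (m (h (f x))) x) = pathstart g"
      using inj[OF hf(3)[OF x]] by (simp add: inj_eq)
    then show ?thesis
      using Ktop[OF hf(3)[OF x] xX] by (simp add: F_def tube_def)
  qed
  have \<rho>0: "\<rho> (0, x) = x" if "x \<in> A" for x
    using HK[OF hf(3)[OF that]] A that by (auto simp: \<rho>_def)
  have \<rho>1: "\<rho> (1, x) \<in> F" if "x \<in> A" for x
    using K_in[OF that] H0 m(3) by (auto simp: \<rho>_def F_def tube_def)
  have \<rho>F: "\<rho> (t, x) \<in> F" if "x \<in> F" for t x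
  proof -
    \<comment> \<open>Over the start of the arc the parameter is 0, so \<open>\<rho>\<close> fixes
      the points of \<open>F\<close> at all times and is a homotopy of maps of pairs.\<close>
    have "h (f x) = 0"
      using that h by (auto simp: F_def tube_def pathstart_def homeomorphism_def)
    moreover have "x \<in> topspace X" using that FA A by blast
    ultimately show ?thesis
      using that KH[of 0 x] H0[of x] m(3) by (simp add: \<rho>_def)
  qed
  have contm: "continuous_map ?I ?I m"
    using m by (auto simp: continuous_map_in_subtopology)
  have "continuous_map (subtopology X A) (top_of_set (path_image g)) f"
    using f by (auto simp: continuous_map_in_subtopology continuous_map_from_subtopology A_def tube_def)
  moreover have "continuous_map (top_of_set (path_image g)) ?I h"
    using h by (auto simp: homeomorphism_def continuous_map_in_subtopology)
  ultimately have conthf: "continuous_map (subtopology X A) ?I (h \<circ> f)"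
    by (rule continuous_map_compose)
  have hfP: "continuous_map ?P ?I (\<lambda>p. h (f (snd p)))"
    using continuous_map_compose[OF continuous_map_snd conthf] by (simp add: o_def)
  have "continuous_map ?P euclidean (\<lambda>p. (1 - fst p) * h (f (snd p)))"
    using hfP continuous_map_fst[of ?I "subtopology X A"]
    by (intro continuous_map_real_mult continuous_map_diff) (auto simp: continuous_map_in_subtopology)
  then have "continuous_map ?P ?I (\<lambda>p. (1 - fst p) * h (f (snd p)))"
    using hf(1) by (auto simp: continuous_map_in_subtopology intro!: mult_le_one)
  from continuous_map_compose[OF this contm]
  have c1: "continuous_map ?P ?I (\<lambda>p. m ((1 - fst p) * h (f (snd p))))"
    by (simp add: o_def)
  have c2: "continuous_map ?P ?I (\<lambda>p. m (h (f (snd p))))"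
    using continuous_map_compose[OF hfP contm] by (simp add: o_def)
  have "continuous_map ?P X snd"
    using continuous_map_snd[of ?I "subtopology X A"] continuous_map_into_fulltopology by blast
  from continuous_map_compose[OF continuous_map_pairedI[OF c2 this] contK]
  have "continuous_map ?P X (\<lambda>p. K (m (h (f (snd p)))) (snd p))"
    by (simp add: o_def)
  from continuous_map_compose[OF continuous_map_pairedI[OF c1 this] isotopy_continuous_map[OF H]]
  have cont\<rho>: "continuous_map ?P X \<rho>"
    by (simp add: o_def \<rho>_def case_prod_unfold)
  have "homotopic_with (\<lambda>h. h \<in> F \<rightarrow> F) (subtopology X A) X (\<lambda>x. \<rho> (0, x)) (\<lambda>x. \<rho> (1, x))"
    unfolding homotopic_with_def using cont\<rho> \<rho>F by (intro exI[of _ \<rho>]) auto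
  then have eq: "hom_induced k (subtopology X A) F X F (\<lambda>x. \<rho> (0, x))
      = hom_induced k (subtopology X A) F X F (\<lambda>x. \<rho> (1, x))"
    by (rule homology_homotopy_axiom)
  have "continuous_map (subtopology X A) ?P (\<lambda>x. (1, x))"
    by (simp add: continuous_map_pairedI)
  from continuous_map_compose[OF this cont\<rho>]
  have cont1: "continuous_map (subtopology X A) (subtopology X F) (\<lambda>x. \<rho> (1, x))"
    using \<rho>1 by (auto simp: continuous_map_in_subtopology o_def)
  let ?G = "relative_homology_group k X F"
  let ?j = "hom_induced k X F X A id"
  let ?i = "hom_induced k (subtopology X A) F X F id"
  \<comment> \<open>The retraction along the isotopy shows that \<open>?i\<close> factors through the homology of \<open>(F, F)\<close>.\<close>
  have triv: "?i z = \<one>\<^bsub>?G\<^esub>" for z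
  proof -
    let ?z = "hom_induced k (subtopology X A) F (subtopology X F) F (\<lambda>x. \<rho> (1, x)) z"
    have "?i z = hom_induced k (subtopology X A) F X F (\<lambda>x. \<rho> (0, x)) z"
      by (rule fun_cong[OF hom_induced_eq]) (simp add: \<rho>0)
    also have "\<dots> = hom_induced k (subtopology X F) F X F id ?z"
      unfolding eq using cont1 \<rho>F
      by (subst hom_induced_compose') (auto simp: o_def continuous_map_from_subtopology)
    also have "?z = \<one>\<^bsub>relative_homology_group k (subtopology X F) F\<^esub>"
    proof -
      have "F = topspace (subtopology X F)"
        using FA A by auto
      then have "trivial_group (relative_homology_group k (subtopology X F) F)"
        using trivial_relative_homology_group_topspace by metis
      then show ?thesis
        using hom_induced_carrier by (fastforce simp: trivial_group_def)
    qed
    also have "hom_induced k (subtopology X F) F X F id \<dots> = \<one>\<^bsub>?G\<^esub>"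
      by (simp add: hom_one[OF hom_induced_hom])
    finally show ?thesis .
  qed
  interpret group_hom ?G "relative_homology_group k X A" ?j
    by (simp add: group_hom_def group_hom_axioms_def hom_induced_hom)
  have "?i ` carrier (relative_homology_group k (subtopology X A) F)
      = kernel ?G (relative_homology_group k X A) ?j"
    using homology_exactness_triple_3[OF FA, of k X] by (simp add: exact_seq_cons_iff)
  then have "kernel ?G (relative_homology_group k X A) ?j \<subseteq> {\<one>\<^bsub>?G\<^esub>}"
    using triv by blast
  then show ?thesis
    unfolding F_def[symmetric] A_def[symmetric] inj_on_one_iff by (auto simp: kernel_def)
qed

section \<open>The variation of a relative class under an isotopy\<close>

text \<open>Only the position of the image of \<open>F\<close> during the three time intervals
  matters. The two sides are compared in the homology of \<open>(X, A)\<close>, the common target of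
  the classes from \<open>(X, B)\<close> and \<open>(X, F)\<close>.\<close>

lemma isotopy_variation:
  assumes H: "isotopy X H" and uv: "0 \<le> u" "u \<le> v" "v \<le> 1"
    and FA: "F \<subseteq> A" and BA: "B \<subseteq> A" and BD: "B \<subseteq> D"
    and HA: "\<And>t. t \<in> {0..u} \<union> {v..1} \<Longrightarrow> H t \<in> F \<rightarrow> A"
    and HD: "\<And>t. t \<in> {u..v} \<Longrightarrow> H t \<in> F \<rightarrow> D"
    and HB: "H u \<in> F \<rightarrow> B" "H v \<in> F \<rightarrow> B" and H1: "H 1 \<in> F \<rightarrow> F"
    and \<omega>: "\<omega> \<in> carrier (relative_homology_group k X F)"
  obtains \<psi> where "\<psi> \<in> carrier (relative_homology_group k (subtopology X D) B)"
    and "hom_induced k X B X A id (hom_induced k (subtopology X D) B X B id \<psi>)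
      = hom_induced k X F X A id (hom_induced k X F X F (H 1) \<omega> \<otimes>\<^bsub>relative_homology_group k X F\<^esub>
          inv\<^bsub>relative_homology_group k X F\<^esub> \<omega>)"
proof -
  let ?G = "\<lambda>S. relative_homology_group k X S"
  let ?ind = "\<lambda>S T. hom_induced k X S X T"
  let ?j = "?ind F A id" and ?i = "?ind B A id" and ?d = "?ind B D id"
  have cont: "continuous_map X X (H t)" if "t \<in> {0..1}" for t
    using continuous_map_compose[OF continuous_map_pairedI isotopy_continuous_map[OF H],
        of X "\<lambda>_. t" id] that
    by (simp add: o_def)
  have hom: "group_hom (?G S) (?G T) (?ind S T h)" for S T h
    by (simp add: group_hom_def group_hom_axioms_def hom_induced_hom)
  interpret F: comm_group "?G F" by simp
  interpret B: comm_group "?G B" by simp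
  interpret D: comm_group "?G D" by simp
  interpret j: group_hom "?G F" "?G A" ?j by (rule hom)
  interpret i: group_hom "?G B" "?G A" ?i by (rule hom)
  interpret d: group_hom "?G B" "?G D" ?d by (rule hom)
  note [simp] = \<omega> hom_induced_carrier
  \<comment> \<open>Both \<open>H u\<close> and \<open>H v\<close> send \<open>F\<close> into
    \<open>B\<close>, so their difference already makes sense relative to \<open>B\<close>.\<close>
  define e where "e = ?ind F B (H v) \<omega> \<otimes>\<^bsub>?G B\<^esub> inv\<^bsub>?G B\<^esub> ?ind F B (H u) \<omega>"
  have compB: "?ind B T id (?ind F B (H t) \<omega>) = ?ind F T (H t) \<omega>"
    if "t \<in> {u, v}" "B \<subseteq> T" for t T
    using that uv HB cont[of t] by (subst hom_induced_compose') auto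
  \<comment> \<open>Between \<open>u\<close> and \<open>v\<close> the image of \<open>F\<close>
    stays in \<open>D\<close>, so \<open>e\<close> dies relative to \<open>D\<close> and by
    exactness comes from \<open>(D, B)\<close>.\<close>
  have "?ind F D (H u) \<omega> = ?ind F D (H v) \<omega>"
    using isotopy_hom_induced_eq[OF H uv HD] by metis
  then have "?d e = \<one>\<^bsub>?G D\<^esub>"
    using BD by (simp add: e_def compB)
  moreover have "e \<in> carrier (?G B)"
    by (simp add: e_def)
  moreover have "hom_induced k (subtopology X D) B X B id ` carrier (relative_homology_group k (subtopology X D) B)
      = kernel (?G B) (?G D) ?d"
    using homology_exactness_triple_3[OF BD, of k X] by (simp add: exact_seq_cons_iff)
  ultimately obtain \<psi> where \<psi>: "\<psi> \<in> carrier (relative_homology_group k (subtopology X D) B)"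
    "hom_induced k (subtopology X D) B X B id \<psi> = e"
    unfolding kernel_def by (metis (mono_tags, lifting) imageE mem_Collect_eq)
  let ?T = "?ind F F (H 1) \<omega>"
  have "?j ?T = ?ind F A (H 1) \<omega>"
    using H1 FA cont[of 1] by (subst hom_induced_compose') auto
  also have "\<dots> = ?ind F A (H v) \<omega>"
    using isotopy_hom_induced_eq[OF H, of v 1 F A k] uv HA by simp
  finally have jT: "?j ?T = ?ind F A (H v) \<omega>" .
  \<comment> \<open>\<open>H 0\<close> is known to be the identity only on
    \<open>topspace X\<close>, which suffices for equal induced maps.\<close>
  have "?j \<omega> = ?ind F A (H 0) \<omega>"
    by (rule fun_cong[OF hom_induced_eq]) (use H in \<open>simp add: isotopy_def\<close>)
  also have "\<dots> = ?ind F A (H u) \<omega>"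
    using isotopy_hom_induced_eq[OF H, of 0 u F A k] uv HA by simp
  finally have j\<omega>: "?j \<omega> = ?ind F A (H u) \<omega>" .
  have "?i e = ?j (?T \<otimes>\<^bsub>?G F\<^esub> inv\<^bsub>?G F\<^esub> \<omega>)"
    using BA by (simp add: e_def compB jT j\<omega>)
  then show thesis
    using that[of \<psi>] \<psi> by simp
qed

section \<open>The time schedule of the monodromy loop\<close>

text \<open>The nested \<open>+++\<close> gives the outward path the time up to 1/2, the circle the
  time from 1/2 to 3/4, and the way back the rest. The intervals are closed, since consecutive paths
  agree where they meet.\<close>

lemma monodromy_loop_simps:
  "0 \<le> t \<Longrightarrow> t \<le> 1/2 \<Longrightarrow> monodromy_loop a g t = g (2 * t)"
  "1/2 \<le> t \<Longrightarrow> t \<le> 3/4 \<Longrightarrow>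
     monodromy_loop a g t = a + (pathfinish g - a) * cis (2 * pi * (4 * t - 2))"
  "3/4 \<le> t \<Longrightarrow> t \<le> 1 \<Longrightarrow> monodromy_loop a g t = g (4 - 4 * t)"
proof -
  show "monodromy_loop a g t = g (2 * t)" if "0 \<le> t" "t \<le> 1/2"
    using that by (simp add: monodromy_loop_def joinpaths_def)
  show "monodromy_loop a g t = a + (pathfinish g - a) * cis (2 * pi * (4 * t - 2))"
    if t: "1/2 \<le> t" "t \<le> 3/4"
  proof (cases "t = 1/2")
    case True
    show ?thesis unfolding True by (simp add: monodromy_loop_def joinpaths_def pathfinish_def)
  next
    case False
    moreover have "2 * (2 * t - 1) = 4 * t - 2" "(2 * t - 1) * 2 = 4 * t - 2" by simp_all
    ultimately show ?thesis using t by (simp add: monodromy_loop_def joinpaths_def)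
  qed
  show "monodromy_loop a g t = g (4 - 4 * t)" if t: "3/4 \<le> t" "t \<le> 1"
  proof (cases "t = 3/4")
    case True
    show ?thesis unfolding True by (simp add: monodromy_loop_def joinpaths_def pathfinish_def)
  next
    case False
    moreover have "1 - (2 * (2 * t - 1) - 1) = 4 - 4 * t" by simp
    ultimately show ?thesis
      using t by (simp add: monodromy_loop_def joinpaths_def reversepath_def)
  qed
qed

section \<open>The monodromy in the direct sum decomposition\<close>

theorem proposition5p1:
  fixes Z :: "'a topology" and \<A> :: "('a, 'n::finite) chart set"
    and L :: "('a, 'l) line_bundle" and p q :: "'a \<Rightarrow> 'l" and x :: 'a
    and \<W> :: "('a \<times> (complex \<times> complex) set) set set"
    and c s :: complex and R :: real and r :: "complex \<Rightarrow> real"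
    and \<gamma> :: "complex \<Rightarrow> real \<Rightarrow> complex"
    and \<Phi> :: "complex \<Rightarrow> real \<Rightarrow> complex \<Rightarrow> complex"
    and H :: "complex \<Rightarrow> real \<Rightarrow> 'a \<Rightarrow> 'a"
  defines "X \<equiv> pole_complement Z L q"
    and "f \<equiv> quotient_fun L p q"
    and "\<Lambda>P \<equiv> atypical_set Z (completed_set Z L p q) \<W>"
  defines "\<Lambda> \<equiv> {w. aff w \<in> \<Lambda>P}"
    and "F \<equiv> tube X f {s}"
  assumes setting: "local_setting Z \<A> x L p q \<or> global_setting Z \<A> L p q"
    and strat: "whitney_stratification (prod_topology Z P1) (prod_P1_atlas \<A>)
                  (completed_set Z L p q) \<W>"
    and stratum: "P1_graph X f \<in> \<W>"
    and finite: "finite \<Lambda>P"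
    and paths: "path_system \<Lambda> c R s r \<gamma>"
    and monodromy: "\<forall>a\<in>\<Lambda>. monodromy_isotopy X f \<Lambda>P a (\<gamma> a) (\<Phi> a) (H a)"
  shows "\<forall>a\<in>\<Lambda>. \<forall>k::int. \<forall>\<omega>\<in>carrier (relative_homology_group k X F).
           \<exists>\<psi>\<in>carrier (local_homology k X f r \<gamma> a).
             hom_induced k X F X F (H a 1) \<omega> =
               \<omega> \<otimes>\<^bsub>relative_homology_group k X F\<^esub>
                 direct_sum_hom k X f \<Lambda> s r \<gamma> (single \<Lambda> (local_homology k X f r \<gamma>) a \<psi>)"
proof (intro ballI allI)
  fix a k \<omega>
  assume a: "a \<in> \<Lambda>" and \<omega>: "\<omega> \<in> carrier (relative_homology_group k X F)"
  let ?G = "relative_homology_group k X F"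
  let ?T = "hom_induced k X F X F (H a 1) \<omega>"
  interpret G: comm_group ?G by simp
  have contf: "continuous_map X euclidean f"
    unfolding X_def f_def using setting unfolding local_setting_def global_setting_def
    by (blast intro: continuous_map_quotient_fun)
  \<comment> \<open>\<open>finprod\<close> over an infinite set would be the neutral element by
    default.\<close>
  have fin: "finite \<Lambda>"
    unfolding \<Lambda>_def using finite_vimageI[OF finite, of aff]
    by (simp add: vimage_def inj_on_def aff_eq_iff)
  have arc: "arc (\<gamma> b)" and start: "pathstart (\<gamma> b) = s"
    and finish: "pathfinish (\<gamma> b) \<in> sphere b (r b)" if "b \<in> \<Lambda>" for b
    using paths that unfolding path_system_def by auto
  have iso: "isotopy X (H b)" "isotopy euclidean (\<Phi> b)"
    and loop: "\<And>t. t \<in> {0..1} \<Longrightarrow> \<Phi> b t s = monodromy_loop b (\<gamma> b) t"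
    and lift: "\<And>t y. t \<in> {0..1} \<Longrightarrow> y \<in> topspace X \<Longrightarrow> f (H b t y) = \<Phi> b t (f y)"
    if "b \<in> \<Lambda>" for b
    using monodromy that start[OF that] unfolding monodromy_isotopy_def by auto
  \<comment> \<open>Injectivity is established for every \<open>b\<close>, because every factor of
    the product in \<open>direct_sum_hom\<close> passes through an \<open>inv_into\<close>.\<close>
  have inj: "inj_on (hom_induced k X F X (tube X f (path_image (\<gamma> b))) id) (carrier ?G)"
    if b: "b \<in> \<Lambda>" for b
    unfolding F_def start[OF b, symmetric]
  \<comment> \<open>The loop runs along \<open>\<gamma> b\<close> at double speed first, so
    \<open>\<Phi> b\<close> at time \<open>t / 2\<close> moves \<open>s\<close> to
    \<open>\<gamma> b t\<close>.\<close>
  proof (rule isotopy_section_inj_hom_induced[OF contf arc[OF b] iso(1)[OF b],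
        where m = "\<lambda>t. t / 2" and \<Phi> = "\<Phi> b"])
    show "inj (\<Phi> b t)" if "t \<in> {0..1}" for t
      using isotopy_inverse[OF iso(2)[OF b]] that by (metis UNIV_I injI topspace_euclidean)
    show "\<Phi> b (t / 2) (pathstart (\<gamma> b)) = \<gamma> b t" if "t \<in> {0..1}" for t
      using that by (simp add: start b loop monodromy_loop_simps)
  qed (use b lift in \<open>auto intro!: continuous_intros\<close>)
  let ?F = "\<lambda>A. tube X f A" and ?g = "\<gamma> a"
  have H_in: "H a t \<in> F \<rightarrow> ?F A" if "t \<in> {0..1}" "monodromy_loop a ?g t \<in> A" for t A
  proof
    fix y assume "y \<in> F"
    then have y: "y \<in> topspace X" "f y = s" by (auto simp: F_def tube_def)
    have "(case (t, y) of (t, y) \<Rightarrow> H a t y) \<in> topspace X"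
      using continuous_map_image_subset_topspace[OF isotopy_continuous_map[OF iso(1)[OF a]]]
        that(1) y(1) by fastforce
    then show "H a t y \<in> ?F A"
      using y that lift[OF a that(1) y(1)] loop[OF a that(1)] by (simp add: tube_def)
  qed
  have image: "?g t \<in> path_image ?g" if "t \<in> {0..1}" for t
    using that by (simp add: path_image_def)
  have base: "monodromy_loop a ?g (1/2) = pathfinish ?g" "monodromy_loop a ?g (3/4) = pathfinish ?g"
    "monodromy_loop a ?g 1 = s"
    by (auto simp: monodromy_loop_simps start[OF a, symmetric] pathfinish_def pathstart_def)
  obtain \<psi> where \<psi>: "\<psi> \<in> carrier (relative_homology_group k (subtopology X (?F (cball a (r a)))) (?F {pathfinish ?g}))"
    and eq: "hom_induced k X (?F {pathfinish ?g}) X (?F (path_image ?g)) id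
        (hom_induced k (subtopology X (?F (cball a (r a)))) (?F {pathfinish ?g}) X (?F {pathfinish ?g}) id \<psi>)
      = hom_induced k X F X (?F (path_image ?g)) id (?T \<otimes>\<^bsub>?G\<^esub> inv\<^bsub>?G\<^esub> \<omega>)"
  \<comment> \<open>The circle is traversed from time 1/2 to time 3/4, beginning and ending at
    \<open>pathfinish ?g\<close>.\<close>
  proof (rule isotopy_variation[OF iso(1)[OF a], where u = "1/2" and v = "3/4" and F = F
        and A = "?F (path_image ?g)" and B = "?F {pathfinish ?g}" and D = "?F (cball a (r a))"
        and k = k and \<omega> = \<omega>])
    show "F \<subseteq> ?F (path_image ?g)" "?F {pathfinish ?g} \<subseteq> ?F (path_image ?g)"
      "?F {pathfinish ?g} \<subseteq> ?F (cball a (r a))"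
      using start[OF a] finish[OF a] pathstart_in_path_image[of ?g] pathfinish_in_path_image[of ?g]
      by (auto simp: F_def tube_def)
    show "H a t \<in> F \<rightarrow> ?F (path_image ?g)" if "t \<in> {0..1/2} \<union> {3/4..1}" for t
      using that by (intro H_in) (auto simp: monodromy_loop_simps intro!: image)
    \<comment> \<open>\<open>cis\<close> has norm 1, so the loop stays at distance
      \<open>r a\<close> from \<open>a\<close>.\<close>
    show "H a t \<in> F \<rightarrow> ?F (cball a (r a))" if "t \<in> {1/2..3/4}" for t
      using that finish[OF a]
      by (intro H_in) (auto simp: monodromy_loop_simps dist_norm norm_mult norm_minus_commute)
    show "H a (1/2) \<in> F \<rightarrow> ?F {pathfinish ?g}" "H a (3/4) \<in> F \<rightarrow> ?F {pathfinish ?g}"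
      by (intro H_in; simp add: base)+
    show "H a 1 \<in> F \<rightarrow> F"
      unfolding F_def[symmetric] using H_in[of 1 "{s}"] by (simp add: base F_def)
  qed (use \<omega> in auto)
  let ?L = "local_homology k X f r \<gamma>"
  let ?S = "summand_hom k X f r \<gamma>"
  \<comment> \<open>The neutral element is a preimage of the neutral element, and by injectivity it
    is the one that \<open>inv_into\<close> returns.\<close>
  have one: "?S b \<one>\<^bsub>?L b\<^esub> = \<one>\<^bsub>?G\<^esub>" if b: "b \<in> \<Lambda>" for b
    using inv_into_f_f[OF inj[OF b] G.one_closed]
    by (simp add: summand_hom_def transport_hom_def local_homology_def start b F_def[symmetric]
        hom_one[OF hom_induced_hom])
  \<comment> \<open>\<open>eq\<close> exhibits a preimage of the class to be transported;
    injectivity makes \<open>inv_into\<close> return exactly this one.\<close>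
  have S\<psi>: "?S a \<psi> = ?T \<otimes>\<^bsub>?G\<^esub> inv\<^bsub>?G\<^esub> \<omega>"
    using inv_into_f_f[OF inj[OF a]] eq \<omega>
    by (simp add: summand_hom_def transport_hom_def start[OF a] F_def[symmetric] hom_induced_carrier)
  then have \<psi>_in: "?S a \<psi> \<in> carrier ?G"
    using \<omega> by (simp add: hom_induced_carrier)
  \<comment> \<open>\<open>single\<close> puts neutral elements at all indices other than
    \<open>a\<close>, so the product collapses to one factor.\<close>
  have "direct_sum_hom k X f \<Lambda> s r \<gamma> (single \<Lambda> ?L a \<psi>)
      = (\<Otimes>\<^bsub>?G\<^esub>b\<in>\<Lambda>. if a = b then ?S a \<psi> else \<one>\<^bsub>?G\<^esub>)"
    unfolding direct_sum_hom_def F_def[symmetric]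
    by (rule G.finprod_cong') (use \<psi>_in one in \<open>auto simp: single_def\<close>)
  also have "\<dots> = ?S a \<psi>"
    using G.finprod_singleton[OF a fin, of "\<lambda>_. ?S a \<psi>"] \<psi>_in by simp
  finally have sum: "direct_sum_hom k X f \<Lambda> s r \<gamma> (single \<Lambda> ?L a \<psi>) = ?S a \<psi>" .
  have "\<omega> \<otimes>\<^bsub>?G\<^esub> direct_sum_hom k X f \<Lambda> s r \<gamma> (single \<Lambda> ?L a \<psi>) = ?T"
    unfolding sum S\<psi> using \<omega> by (subst G.m_lcomm) (auto simp: hom_induced_carrier)
  then show "\<exists>\<psi>\<in>carrier (?L a). ?T =
      \<omega> \<otimes>\<^bsub>?G\<^esub> direct_sum_hom k X f \<Lambda> s r \<gamma> (single \<Lambda> ?L a \<psi>)"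
    using \<psi> by (auto simp: local_homology_def)
qed

end
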